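(* Let $L$ be an infinite locally compact Hausdorff topological space that does not contain isolated points. Then every somewhat regular linear subspace of $C_0(L)$ contains $\ell_1$, and even contains asymptotically isometric copies of $\ell_1$.
   Context: $\mathbb{K}$ denotes either $\mathbb{R}$ or $\mathbb{C}$, and $C_0(L)$ is the Banach space of continuous $\mathbb{K}$-valued functions on $L$ vanishing at infinity, with the supremum norm. A linear subspace $\mathcal{A}$ of $C_0(L)$ (not assumed to be closed) is called somewhat regular if, whenever $V$ is a non-empty open subset of $L$ and $0<\varepsilon<1$, there is an $f\in\mathcal{A}$ such that $\|f\|=1$ and $|f(x)|\leq\varepsilon$ for every $x\in L\setminus V$. A normed space $X$ over $\mathbb{K}$ contains $\ell_1$ if it has a linear subspace isomorphic to $\ell_1$. It contains an asymptotically isometric copy of $\ell_1$ if there exist a sequence $(\varepsilon_n)_{n=1}^\infty$ in $(0,1)$ with $\varepsilon_n\to 0$ and a sequence $(x_n)_{n=1}^\infty$ in $X$ such that, for every $(a_n)\in\ell_1$, the series $\sum_{n=1}^\infty a_n x_n$ converges in $X$ and $$\sum_{n=1}^\infty(1-\varepsilon_n)|a_n|\leq\biggl\|\sum_{n=1}^\infty a_n x_n\biggr\|\leq\sum_{n=1}^\infty|a_n|.$$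
   Formalization: For a non-closed somewhat regular subspace the copies of ℓ₁ are found in its closure, with the generating sequence in the subspace; the subspace itself contains them when closed. Polynomials on [0,1] refute the literal claim. *)

theory Defs
  imports "HOL-Analysis.Analysis"
begin

definition scale_bcontfun ::
  "'k::real_normed_field \<Rightarrow> ('a::topological_space \<Rightarrow>\<^sub>C 'k) \<Rightarrow> ('a \<Rightarrow>\<^sub>C 'k)" where
  "scale_bcontfun c f = Bcontfun (\<lambda>x. c * f x)"

lemma apply_scale_bcontfun [simp]: "scale_bcontfun c f x = c * f x"
proof -
  obtain B where "\<And>x. norm (f x) \<le> B"
    using bounded_apply_bcontfun[of f] by (auto simp: bounded_iff)
  then have "norm (c * f x) \<le> norm c * B" for x
    by (simp add: norm_mult mult_left_mono)
  then have "bounded (range (\<lambda>x. c * f x))"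
    by (auto simp: bounded_iff)
  then have "(\<lambda>x. c * f x) \<in> bcontfun"
    by (auto simp: bcontfun_def intro!: continuous_intros)
  then show ?thesis
    by (simp add: scale_bcontfun_def Bcontfun_inverse)
qed

text \<open>
  The library only makes the type of bounded continuous functions a real vector space; this is
  its structure over the scalar field \<open>'k\<close> (used below for the reals and the complex numbers).
  Subspaces are therefore taken with respect to \<open>'k\<close>.
\<close>

global_interpretation bcf: vector_space
  "scale_bcontfun :: 'k::real_normed_field \<Rightarrow> ('a::topological_space \<Rightarrow>\<^sub>C 'k) \<Rightarrow> _"
  by unfold_locales (auto intro!: bcontfun_eqI simp: plus_bcontfun.rep_eq algebra_simps)

text \<open>
  The space of continuous functions vanishing at infinity, as a subset of the bounded continuous
  functions, whose library norm is the supremum norm.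
\<close>

definition C0 :: "('a::topological_space \<Rightarrow>\<^sub>C 'k::real_normed_field) set" where
  "C0 = {f :: 'a \<Rightarrow>\<^sub>C 'k. \<forall>e>0. compact {x. e \<le> norm (f x)}}"

definition somewhat_regular :: "('a::topological_space \<Rightarrow>\<^sub>C 'k::real_normed_field) set \<Rightarrow> bool" where
  "somewhat_regular A \<longleftrightarrow> bcf.subspace A \<and> A \<subseteq> C0 \<and>
     (\<forall>V \<epsilon>. open V \<and> V \<noteq> {} \<and> 0 < \<epsilon> \<and> \<epsilon> < 1 \<longrightarrow>
        (\<exists>f\<in>A. norm f = 1 \<and> (\<forall>x\<in>- V. norm (apply_bcontfun f x) \<le> \<epsilon>)))"

definition ell1 :: "(nat \<Rightarrow> 'k::real_normed_field) set" where
  "ell1 = {a. summable (\<lambda>n. norm (a n))}"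

definition ell1_norm :: "(nat \<Rightarrow> 'k::real_normed_field) \<Rightarrow> real" where
  "ell1_norm a = (\<Sum>n. norm (a n))"

text \<open>
  \<open>X\<close> has a linear subspace \<open>Y\<close> and a linear bijection \<open>T\<close> from \<open>ell1\<close> onto \<open>Y\<close> such that \<open>T\<close> and
  its inverse are bounded.
\<close>

definition contains_ell1 :: "('a::topological_space \<Rightarrow>\<^sub>C 'k::real_normed_field) set \<Rightarrow> bool" where
  "contains_ell1 X \<longleftrightarrow>
     (\<exists>Y T. Y \<subseteq> X \<and> bcf.subspace Y \<and> bij_betw T ell1 Y \<and>
        (\<forall>a\<in>ell1. \<forall>b\<in>ell1. T (\<lambda>n. a n + b n) = T a + T b) \<and>
        (\<forall>c. \<forall>a\<in>ell1. T (\<lambda>n. c * a n) = scale_bcontfun c (T a)) \<and>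
        (\<exists>M. \<forall>a\<in>ell1. norm (T a) \<le> M * ell1_norm a) \<and>
        (\<exists>M. \<forall>a\<in>ell1. ell1_norm a \<le> M * norm (T a)))"

text \<open>
  The sum \<open>s\<close> is required to lie in \<open>X\<close>: for a subspace \<open>X\<close> that is not closed, convergence in \<open>X\<close>
  is more than convergence in the surrounding Banach space.
\<close>

definition asymp_isometric_ell1_seq ::
  "('a::topological_space \<Rightarrow>\<^sub>C 'k::real_normed_field) set \<Rightarrow> (nat \<Rightarrow> real) \<Rightarrow> (nat \<Rightarrow> 'a \<Rightarrow>\<^sub>C 'k) \<Rightarrow> bool"
  where
  "asymp_isometric_ell1_seq X \<epsilon> x \<longleftrightarrow>
     (\<forall>n. 0 < \<epsilon> n \<and> \<epsilon> n < 1) \<and> \<epsilon> \<longlonglongrightarrow> 0 \<and> (\<forall>n. x n \<in> X) \<and>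
     (\<forall>a\<in>ell1. \<exists>s\<in>X. (\<lambda>n. scale_bcontfun (a n) (x n)) sums s \<and>
        (\<Sum>n. (1 - \<epsilon> n) * norm (a n)) \<le> norm s \<and> norm s \<le> (\<Sum>n. norm (a n)))"

definition contains_asymp_isometric_ell1 ::
  "('a::topological_space \<Rightarrow>\<^sub>C 'k::real_normed_field) set \<Rightarrow> bool" where
  "contains_asymp_isometric_ell1 X \<longleftrightarrow> (\<exists>\<epsilon> x. asymp_isometric_ell1_seq X \<epsilon> x)"

end

theory Submission
  imports Defs
begin

text \<open>
  Since no point is isolated, distinct points can be picked in any finite list of non-empty open
  sets, with repetitions, and then surrounded by disjoint open sets. Adding up functions of the
  subspace that are concentrated on these sets, each multiplied by a suitable scalar, gives a
  function of norm at most one which is close to prescribed scalars of modulus one on non-empty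
  open subsets of the given sets. Iterating this with finer and finer finite nets of the unit
  sphere of the scalar field yields \<open>f\<^sub>0, f\<^sub>1, \<dots>\<close> such that all finite patterns of
  scalars from the nets are nearly attained simultaneously at some point; choosing the pattern
  that cancels the arguments of the \<open>a\<^sub>n\<close> gives the lower \<open>ell1\<close> estimate.
\<close>

section \<open>Scalar multiples, finite sums and series of bounded continuous functions\<close>

lemma norm_scale_bcontfun:
  "norm (scale_bcontfun c f) = norm c * norm (f :: 'a::topological_space \<Rightarrow>\<^sub>C 'k::real_normed_field)"
proof (rule antisym)
  \<comment> \<open>Stated for arbitrary \<open>c\<close> and \<open>f\<close>, because the reverse
    inequality is this bound applied to \<open>inverse c\<close> and
    \<open>scale_bcontfun c f\<close>.\<close>
  have le: "norm (scale_bcontfun c f) \<le> norm c * norm f" for c and f :: "'a \<Rightarrow>\<^sub>C 'k"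
    by (rule norm_bound) (simp add: norm_mult mult_left_mono norm_bounded)
  show "norm (scale_bcontfun c f) \<le> norm c * norm f"
    by (rule le)
  show "norm c * norm f \<le> norm (scale_bcontfun c f)"
  proof (cases "c = 0")
    case False
    then have "f = scale_bcontfun (inverse c) (scale_bcontfun c f)"
      by (intro bcontfun_eqI) simp
    then have "norm f \<le> norm (inverse c) * norm (scale_bcontfun c f)"
      by (metis le)
    then have "norm c * norm f \<le> norm c * (norm (inverse c) * norm (scale_bcontfun c f))"
      by (rule mult_left_mono) simp
    with False show ?thesis
      by (simp add: norm_inverse flip: mult.assoc)
  qed simp
qed

lemma apply_sum_bcontfun:
  "apply_bcontfun (\<Sum>i\<in>I. f i) x = (\<Sum>i\<in>I. apply_bcontfun (f i) x)"
  for f :: "'i \<Rightarrow> 'a::topological_space \<Rightarrow>\<^sub>C 'k::real_normed_vector"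
  by (induction I rule: infinite_finite_induct) (auto simp: plus_bcontfun.rep_eq)

text \<open>The library proves that bounded continuous functions form a complete space only when the
  domain is a metric space.\<close>

lemma summable_bcontfun_comparison:
  fixes f :: "nat \<Rightarrow> 'a::topological_space \<Rightarrow>\<^sub>C 'b::banach"
  assumes "\<And>n. norm (f n) \<le> M n" "summable M"
  shows "summable f"
proof -
  have "norm (f n x) \<le> M n" for n x
    using norm_bounded[of "f n" x] assms(1)[of n] by linarith
  then have "uniform_limit UNIV (\<lambda>n x. \<Sum>i<n. f i x) (\<lambda>x. \<Sum>i. f i x) sequentially"
    using assms(2) by (intro Weierstrass_m_test) auto
  moreover have "(\<lambda>x. \<Sum>i<n. f i x) = apply_bcontfun (\<Sum>i<n. f i)" for n
    by (intro ext) (simp add: apply_sum_bcontfun)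
  ultimately have "uniform_limit UNIV (\<lambda>n. apply_bcontfun (\<Sum>i<n. f i)) (\<lambda>x. \<Sum>i. f i x) sequentially"
    by simp
  then obtain l where "(\<lambda>n. \<Sum>i<n. f i) \<longlonglongrightarrow> l"
    by (rule uniform_limit_bcontfunE) simp_all
  then show ?thesis by (auto simp: summable_def sums_def)
qed

section \<open>Choosing and separating points when no point is isolated\<close>

text \<open>Finite sets are closed in a T1 space, so removing all but one point from a finite open
  set would leave an open singleton.\<close>

lemma infinite_open:
  fixes V :: "'a::t1_space set"
  assumes "\<And>x::'a. \<not> open {x}" "open V" "V \<noteq> {}"
  shows "infinite V"
proof
  assume fin: "finite V"
  obtain x where x: "x \<in> V" using assms by blast
  have "open (V - (V - {x}))"
    using assms fin by (intro open_Diff finite_imp_closed) auto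
  moreover have "V - (V - {x}) = {x}" using x by auto
  ultimately show False using assms by simp
qed

text \<open>Greedy choice: the finitely many points already picked cannot exhaust the next infinite
  set. The sets may overlap or coincide.\<close>

lemma injective_selection:
  assumes "finite I" "\<And>i. i \<in> I \<Longrightarrow> infinite (S i)"
  shows "\<exists>p. inj_on p I \<and> (\<forall>i\<in>I. p i \<in> S i)"
  using assms
proof (induction I rule: finite_induct)
  case (insert i I)
  then obtain p where p: "inj_on p I" "\<forall>i\<in>I. p i \<in> S i" by auto
  obtain y where y: "y \<in> S i" "y \<notin> p ` I"
    using insert by (metis finite_imageI finite_subset insertI1 subsetI)
  have "inj_on (p(i := y)) (insert i I)"
    using p y insert by (auto simp: inj_on_def)
  moreover have "\<forall>j\<in>insert i I. (p(i := y)) j \<in> S j"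
    using p y by auto
  ultimately show ?case by blast
qed simp

lemma finite_points_separated:
  fixes p :: "'i \<Rightarrow> 'a::t2_space"
  assumes "finite I" "inj_on p I"
  shows "\<exists>U. (\<forall>i\<in>I. open (U i) \<and> p i \<in> U i) \<and> disjoint_family_on U I"
proof -
  have "\<exists>A B. open A \<and> open B \<and> x \<in> A \<and> y \<in> B \<and> A \<inter> B = {}" if "x \<noteq> y" for x y :: 'a
    using hausdorff[OF that] by blast
  then obtain A B :: "'a \<Rightarrow> 'a \<Rightarrow> 'a set" where AB:
    "\<And>x y. x \<noteq> y \<Longrightarrow> open (A x y) \<and> open (B x y) \<and> x \<in> A x y \<and> y \<in> B x y \<and> A x y \<inter> B x y = {}"
    by metis
  \<comment> \<open>The chosen pair \<open>A x y\<close>, \<open>B x y\<close> need not be symmetric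
    in \<open>x\<close> and \<open>y\<close>. Intersecting with both kinds puts \<open>U i\<close>
    inside \<open>A (p i) (p j)\<close> and \<open>U j\<close> inside \<open>B (p i) (p j)\<close>,
    which are disjoint.\<close>
  define U where "U i = (\<Inter>j\<in>I - {i}. A (p i) (p j) \<inter> B (p j) (p i))" for i
  have ne: "p i \<noteq> p j" if "i \<in> I" "j \<in> I" "i \<noteq> j" for i j
    using assms that by (auto simp: inj_on_def)
  have "open (U i) \<and> p i \<in> U i" if i: "i \<in> I" for i
  proof
    have "open (A (p i) (p j) \<inter> B (p j) (p i))" if "j \<in> I - {i}" for j
      using AB[of "p i" "p j"] AB[of "p j" "p i"] ne[of i j] i that by auto
    then show "open (U i)"
      unfolding U_def using assms(1) by (intro open_INT) auto
    show "p i \<in> U i"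
      unfolding U_def
    proof
      fix j assume "j \<in> I - {i}"
      then show "p i \<in> A (p i) (p j) \<inter> B (p j) (p i)"
        using AB[of "p i" "p j"] AB[of "p j" "p i"] ne[of i j] i by auto
    qed
  qed
  moreover have "U i \<inter> U j = {}" if "i \<in> I" "j \<in> I" "i \<noteq> j" for i j
  proof -
    have "U i \<subseteq> A (p i) (p j)" "U j \<subseteq> B (p i) (p j)"
      using that by (auto simp: U_def)
    then show ?thesis using AB[OF ne[OF that]] by blast
  qed
  ultimately show ?thesis
    unfolding disjoint_family_on_def by (intro exI[of _ U]) simp
qed

section \<open>Functions of the subspace with prescribed approximate values\<close>

text \<open>The norm 1 is a supremum, so some value has modulus above \<open>1 - \<delta>\<close>.
  This exceeds \<open>\<delta>\<close> because \<open>\<delta> < 1/2\<close>, which forces the point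
  into \<open>V\<close>; a rotation then makes the value real and positive.\<close>

lemma somewhat_regular_peak:
  fixes A :: "('a::topological_space \<Rightarrow>\<^sub>C 'k::real_normed_field) set"
  assumes A: "somewhat_regular A" and V: "open V" "V \<noteq> {}" and d: "0 < \<delta>" "\<delta> < 1/2"
  shows "\<exists>g x. g \<in> A \<and> norm g \<le> 1 \<and> (\<forall>y. y \<notin> V \<longrightarrow> norm (g y) \<le> \<delta>) \<and> x \<in> V \<and> norm (g x - 1) \<le> \<delta>"
proof -
  have "0 < \<delta> \<and> \<delta> < 1" using d by auto
  then obtain f where f: "f \<in> A" "norm f = 1" "\<forall>x\<in>- V. norm (f x) \<le> \<delta>"
    using A V unfolding somewhat_regular_def by blast
  have "\<exists>x. 1 - \<delta> < norm (f x)"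
  proof (rule ccontr)
    assume "\<not> ?thesis"
    then have "norm f \<le> 1 - \<delta>" by (intro norm_bound) (simp add: not_less)
    with f d show False by simp
  qed
  then obtain x where x: "1 - \<delta> < norm (f x)" by blast
  have xV: "x \<in> V"
  proof (rule ccontr)
    assume "x \<notin> V"
    then have "norm (f x) \<le> \<delta>" using f by simp
    with x d show False by simp
  qed
  \<comment> \<open>The unimodular factor turning \<open>f x\<close> into its modulus, which lies
    between \<open>1 - \<delta>\<close> and 1.\<close>
  define c where "c = of_real (norm (f x)) / f x"
  have fx: "f x \<noteq> 0" using x d by auto
  have c: "norm c = 1" using fx by (simp add: c_def norm_divide)
  have "norm (f x) \<le> 1" using norm_bounded[of f x] f by simp
  then have "norm (of_real (norm (f x) - 1) :: 'k) \<le> \<delta>"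
    unfolding norm_of_real using x by simp
  then have "norm (scale_bcontfun c f x - 1) \<le> \<delta>"
    using fx by (simp add: c_def)
  moreover have "scale_bcontfun c f \<in> A"
    using A f by (simp add: somewhat_regular_def bcf.subspace_scale)
  ultimately show ?thesis
    using f c xV
    by (intro exI[of _ "scale_bcontfun c f"] exI[of _ x]) (auto simp: norm_scale_bcontfun norm_mult)
qed

text \<open>With peaks \<open>g i\<close> on disjoint sets \<open>U i\<close>, at most one summand
  \<open>\<theta> i * g i\<close> can exceed \<open>\<delta>\<close> in modulus at any given point.
  The sum thus has norm at most \<open>1 + m * \<delta>\<close>, and rescaling it into the unit ball
  moves its values by at most \<open>m * \<delta>\<close>.\<close>

lemma somewhat_regular_prescribed_values:
  fixes \<theta> :: "'i \<Rightarrow> 'k::real_normed_field" and A :: "('a::t2_space \<Rightarrow>\<^sub>C 'k::real_normed_field) set"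
  assumes A: "somewhat_regular A" and iso: "\<And>x::'a. \<not> open {x}"
    and I: "finite I" and V: "\<And>i. i \<in> I \<Longrightarrow> open (V i) \<and> V i \<noteq> {}"
    and t: "\<And>i. i \<in> I \<Longrightarrow> norm (\<theta> i) = 1" and e: "0 < (\<epsilon>::real)"
  shows "\<exists>f\<in>A. norm f \<le> 1 \<and> (\<forall>i\<in>I. \<exists>x\<in>V i. norm (apply_bcontfun f x - \<theta> i) < \<epsilon>)"
proof -
  have sub: "bcf.subspace A" using A by (simp add: somewhat_regular_def)
  define m where "m = real (card I)"
  \<comment> \<open>The bound \<open>1/3\<close> meets the requirement \<open>\<delta> < 1/2\<close>
    for peaks; the other bound makes the final error \<open>(2 * m + 1) * \<delta>\<close> smaller
    than \<open>\<epsilon>\<close>.\<close>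
  define \<delta> where "\<delta> = min (1/3) (\<epsilon> / (2 * (m + 1)))"
  have m: "0 \<le> m" by (simp add: m_def)
  have d: "0 < \<delta>" "\<delta> < 1/2" using e m by (auto simp: \<delta>_def)
  have "\<delta> \<le> \<epsilon> / (2 * (m + 1))" by (simp add: \<delta>_def)
  then have de: "\<delta> * (2 * (m + 1)) \<le> \<epsilon>" using m by (subst (asm) pos_le_divide_eq) auto
  \<comment> \<open>The sets \<open>V i\<close> may coincide for different \<open>i\<close>;
    distinct points in them still give disjoint neighbourhoods.\<close>
  obtain p where p: "inj_on p I" "\<forall>i\<in>I. p i \<in> V i"
    using injective_selection[OF I, of V] infinite_open[OF iso] V by blast
  obtain U0 where U0: "\<forall>i\<in>I. open (U0 i) \<and> p i \<in> U0 i" "disjoint_family_on U0 I"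
    using finite_points_separated[OF I p(1)] by blast
  define U where "U i = U0 i \<inter> V i" for i
  have U: "open (U i)" "U i \<noteq> {}" if "i \<in> I" for i
    using that U0 V p by (auto simp: U_def)
  have disj: "y \<notin> U j" if "i \<in> I" "j \<in> I" "i \<noteq> j" "y \<in> U i" for i j y
    using that U0(2) by (auto simp: U_def disjoint_family_on_def)
  have "\<forall>i\<in>I. \<exists>g x. g \<in> A \<and> norm g \<le> 1 \<and> (\<forall>y. y \<notin> U i \<longrightarrow> norm (g y) \<le> \<delta>) \<and> x \<in> U i \<and> norm (g x - 1) \<le> \<delta>"
    using somewhat_regular_peak[OF A U d] by blast
  then obtain g x where gx: "\<And>i. i \<in> I \<Longrightarrow> g i \<in> A \<and> norm (g i) \<le> 1 \<and>
      (\<forall>y. y \<notin> U i \<longrightarrow> norm (g i y) \<le> \<delta>) \<and> x i \<in> U i \<and> norm (g i (x i) - 1) \<le> \<delta>"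
    by metis
  define S where "S = (\<Sum>i\<in>I. scale_bcontfun (\<theta> i) (g i))"
  have S: "S \<in> A" unfolding S_def
    using gx sub by (intro bcf.subspace_sum bcf.subspace_scale) auto
  have app: "S y = (\<Sum>i\<in>I. \<theta> i * g i y)" for y
    by (simp add: S_def apply_sum_bcontfun)
  \<comment> \<open>Needed for two index sets: \<open>I - {i}\<close> at points of
    \<open>U i\<close>, and all of \<open>I\<close> at points outside every
    \<open>U i\<close>.\<close>
  have small: "norm (\<Sum>j\<in>J. \<theta> j * g j y) \<le> m * \<delta>" if "J \<subseteq> I" "\<And>j. j \<in> J \<Longrightarrow> y \<notin> U j" for J y
  proof -
    have "norm (\<Sum>j\<in>J. \<theta> j * g j y) \<le> real (card J) * \<delta>"
      using that gx t by (intro sum_norm_bound) (auto simp: norm_mult)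
    also have "\<dots> \<le> m * \<delta>"
      using that I d by (auto simp: m_def intro!: mult_right_mono card_mono)
    finally show ?thesis .
  qed
  have split: "S y = \<theta> i * g i y + (\<Sum>j\<in>I - {i}. \<theta> j * g j y)" if "i \<in> I" for i y
    using that I by (simp add: app sum.remove)
  have rest: "norm (\<Sum>j\<in>I - {i}. \<theta> j * g j y) \<le> m * \<delta>" if "i \<in> I" "y \<in> U i" for i y
    using that disj by (intro small) auto
  have bound: "norm (S y) \<le> 1 + m * \<delta>" for y
  proof (cases "\<exists>i\<in>I. y \<in> U i")
    case True
    then obtain i where i: "i \<in> I" "y \<in> U i" by blast
    have "norm (g i y) \<le> 1" using gx[OF i(1)] norm_bounded[of "g i" y] by linarith
    then have "norm (\<theta> i * g i y) \<le> 1" using t i by (simp add: norm_mult)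
    then show ?thesis
      unfolding split[OF i(1)] using rest[OF i] by (intro norm_triangle_le add_mono)
  next
    case False
    then show ?thesis using small[of I y] by (auto simp: app)
  qed
  \<comment> \<open>The factor that brings \<open>S\<close> into the unit ball, given the bound
    \<open>1 + m * \<delta>\<close>.\<close>
  define r where "r = 1 / (1 + m * \<delta>)"
  have md: "0 \<le> m * \<delta>" using m d by simp
  have r: "0 < r" "r * (1 + m * \<delta>) = 1" using md by (auto simp: r_def)
  define f where "f = scale_bcontfun (of_real r) S"
  have "norm S \<le> 1 + m * \<delta>" by (rule norm_bound) (rule bound)
  then have "r * norm S \<le> r * (1 + m * \<delta>)"
    using r(1) by (intro mult_left_mono) auto
  then have "norm f \<le> r * (1 + m * \<delta>)"
    using r(1) by (simp add: f_def norm_scale_bcontfun)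
  then have nf: "norm f \<le> 1" using r by simp
  have close: "norm (f (x i) - \<theta> i) < \<epsilon>" if i: "i \<in> I" for i
  proof -
    have "norm (\<theta> i * (g i (x i) - 1)) \<le> \<delta>"
      using gx[OF i] t[OF i] by (simp add: norm_mult)
    moreover have "norm (\<Sum>j\<in>I - {i}. \<theta> j * g j (x i)) \<le> m * \<delta>"
      using rest[OF i] gx[OF i] by blast
    moreover have "S (x i) - \<theta> i = \<theta> i * (g i (x i) - 1) + (\<Sum>j\<in>I - {i}. \<theta> j * g j (x i))"
      using split[OF i, of "x i"] by (simp add: algebra_simps)
    ultimately have 1: "norm (S (x i) - \<theta> i) \<le> \<delta> + m * \<delta>"
      by (simp add: norm_triangle_le add_mono)
    \<comment> \<open>Writing \<open>S\<close> as a multiple of \<open>f\<close> shows that the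
      rescaling error is \<open>m * \<delta>\<close> times a value of \<open>f\<close>, and these
      values have modulus at most 1.\<close>
    have "S (x i) = of_real (1 + m * \<delta>) * f (x i)"
    proof -
      have "of_real (1 + m * \<delta>) * f (x i) = of_real ((1 + m * \<delta>) * r) * S (x i)"
        by (simp only: f_def apply_scale_bcontfun of_real_mult mult.assoc)
      then show ?thesis using r(2) by (simp only: mult.commute[of _ r] of_real_1 mult_1_left)
    qed
    then have "f (x i) - S (x i) = of_real (- (m * \<delta>)) * f (x i)"
      by (simp add: algebra_simps)
    then have "norm (f (x i) - S (x i)) = m * \<delta> * norm (f (x i))"
      using md by (simp only: norm_mult norm_of_real abs_minus_cancel abs_of_nonneg)
    also have "\<dots> \<le> m * \<delta> * 1"
      using md nf norm_bounded[of f "x i"] by (intro mult_left_mono) auto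
    \<comment> \<open>The three error terms come from the rescaling, from the peak at
      \<open>x i\<close>, and from the other summands there.\<close>
    finally have "norm (f (x i) - \<theta> i) \<le> (m * \<delta>) + (\<delta> + m * \<delta>)"
      using 1 norm_triangle_ineq[of "f (x i) - S (x i)" "S (x i) - \<theta> i"]
      unfolding diff_add_cancel add_diff_eq mult_1_right by linarith
    also have "\<dots> < \<delta> * (2 * (m + 1))" using d by (simp add: algebra_simps)
    finally show ?thesis using de by simp
  qed
  show ?thesis
  proof (intro bexI conjI ballI)
    show "f \<in> A" using S sub by (simp add: f_def bcf.subspace_scale)
    show "norm f \<le> 1" by (rule nf)
    fix i assume i: "i \<in> I"
    show "norm (f (x i) - \<theta> i) < \<epsilon>" by (rule close[OF i])
    show "x i \<in> V i" using gx[OF i] by (simp add: U_def)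
  qed
qed

section \<open>Finite nets of scalars and refinement of finite families of open sets\<close>

lemma finite_net_sphere:
  assumes "0 < (\<epsilon>::real)"
  shows "\<exists>\<Theta>. finite \<Theta> \<and> \<Theta> \<subseteq> sphere (0::'k::{real_normed_field,heine_borel}) 1 \<and>
    (\<forall>z\<in>sphere 0 1. \<exists>\<theta>\<in>\<Theta>. norm (\<theta> - z) < \<epsilon>)"
proof -
  have "compact (sphere (0::'k) 1)"
    by (simp add: compact_eq_bounded_closed)
  then obtain \<Theta> where T: "\<Theta> \<subseteq> sphere (0::'k) 1" "finite \<Theta>" "sphere 0 1 \<subseteq> (\<Union>x\<in>\<Theta>. ball x \<epsilon>)"
    by (rule compactE_image[of _ "sphere 0 1" "\<lambda>x. ball x \<epsilon>"]) (use assms in auto)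
  have "\<exists>\<theta>\<in>\<Theta>. norm (\<theta> - z) < \<epsilon>" if "z \<in> sphere 0 1" for z
    using subsetD[OF T(3) that] by (auto simp: dist_norm)
  with T show ?thesis by blast
qed

lemma somewhat_regular_refine:
  fixes A :: "('a::t2_space \<Rightarrow>\<^sub>C 'k::{real_normed_field,heine_borel}) set"
  assumes A: "somewhat_regular A" and iso: "\<And>x::'a. \<not> open {x}"
    and VV: "finite \<V>" "\<forall>V\<in>\<V>. open V \<and> V \<noteq> {}" and e: "0 < (\<epsilon>::real)"
  shows "\<exists>\<W> f. finite \<W> \<and> (\<forall>W\<in>\<W>. open W \<and> W \<noteq> {}) \<and> f \<in> A \<and> norm f \<le> 1 \<and>
    (\<forall>V\<in>\<V>. \<forall>z. norm z = 1 \<longrightarrow> (\<exists>W\<in>\<W>. W \<subseteq> V \<and> (\<forall>x\<in>W. norm (f x - z) < \<epsilon>)))"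
proof -
  obtain \<Theta> :: "'k set" where T: "finite \<Theta>" "\<Theta> \<subseteq> sphere 0 1"
      "\<forall>z\<in>sphere 0 1. \<exists>\<theta>\<in>\<Theta>. norm (\<theta> - z) < \<epsilon>/2"
    using finite_net_sphere[of "\<epsilon>/2"] e by auto
  \<comment> \<open>The index set \<open>\<V> \<times> \<Theta>\<close> repeats each
    \<open>V\<close> once for every net point, so one \<open>f\<close> comes near every value of the
    net inside every \<open>V\<close>.\<close>
  obtain f where f: "f \<in> A" "norm f \<le> 1"
      "\<forall>i\<in>\<V> \<times> \<Theta>. \<exists>x\<in>fst i. norm (f x - snd i) < \<epsilon>/2"
  proof -
    have "\<exists>f\<in>A. norm f \<le> 1 \<and> (\<forall>i\<in>\<V> \<times> \<Theta>. \<exists>x\<in>fst i. norm (apply_bcontfun f x - snd i) < \<epsilon>/2)"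
    proof (rule somewhat_regular_prescribed_values[OF A iso])
      show "open (fst i) \<and> fst i \<noteq> {}" "norm (snd i) = 1" if "i \<in> \<V> \<times> \<Theta>" for i
        using that VV(2) T(2) by (auto simp: mem_Times_iff)
    qed (use T(1) VV(1) e in auto)
    then show thesis using that by blast
  qed
  \<comment> \<open>Continuity spreads the nearness from one point to an open set. The other half of
    \<open>\<epsilon>\<close> is spent on the distance from \<open>z\<close> to the net.\<close>
  define W where "W i = {x \<in> fst i. norm (f x - snd i) < \<epsilon>/2}" for i
  have W: "open (W i)" if "open (fst i)" for i
  proof -
    have "open {x. norm (f x - snd i) < \<epsilon>/2}"
      by (intro open_Collect_less continuous_intros continuous_on_apply_bcontfun)
    moreover have "W i = fst i \<inter> {x. norm (f x - snd i) < \<epsilon>/2}" by (auto simp: W_def)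
    ultimately show ?thesis using that by auto
  qed
  have "\<exists>W'\<in>W ` (\<V> \<times> \<Theta>). W' \<subseteq> V \<and> (\<forall>x\<in>W'. norm (f x - z) < \<epsilon>)"
    if "V \<in> \<V>" "norm z = 1" for V z
  proof -
    obtain \<theta> where th: "\<theta> \<in> \<Theta>" "norm (\<theta> - z) < \<epsilon>/2" using T(3) \<open>norm z = 1\<close> by force
    have "norm (f x - z) < \<epsilon>" if "norm (f x - \<theta>) < \<epsilon>/2" for x
      using norm_triangle_ineq[of "f x - \<theta>" "\<theta> - z"] that th by simp
    then have "W (V, \<theta>) \<subseteq> V \<and> (\<forall>x\<in>W (V, \<theta>). norm (f x - z) < \<epsilon>)"
      by (simp add: W_def)
    moreover have "W (V, \<theta>) \<in> W ` (\<V> \<times> \<Theta>)"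
      using \<open>V \<in> \<V>\<close> th(1) by (intro imageI) simp
    ultimately show ?thesis by blast
  qed
  moreover have "\<forall>W'\<in>W ` (\<V> \<times> \<Theta>). open W' \<and> W' \<noteq> {}"
    using f(3) VV W by (fastforce simp: W_def)
  ultimately show ?thesis
    using f T VV by (intro exI[of _ "W ` (\<V> \<times> \<Theta>)"] exI[of _ f]) blast
qed

text \<open>Following a pattern \<open>z\<close> means descending through nested sets, one from each
  successive family. The sequence \<open>f\<close> is fixed before \<open>z\<close>, so that only
  the point \<open>x\<close> depends on \<open>z\<close> and \<open>N\<close>.\<close>

lemma somewhat_regular_all_patterns:
  fixes A :: "('a::t2_space \<Rightarrow>\<^sub>C 'k::{real_normed_field,heine_borel}) set"
  assumes A: "somewhat_regular A" and iso: "\<And>x::'a. \<not> open {x}"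
    and e: "\<And>n::nat. 0 < (\<epsilon> n :: real)"
  shows "\<exists>f. (\<forall>n. f n \<in> A \<and> norm (f n) \<le> 1) \<and>
    (\<forall>z N. (\<forall>n. norm (z n) = 1) \<longrightarrow> (\<exists>x. \<forall>n<N. norm (f n x - z n) < \<epsilon> n))"
proof -
  \<comment> \<open>A state pairs the current family of open sets with the function chosen last;
    \<open>P\<close> is the invariant and \<open>Q\<close> the refinement step.\<close>
  define P where "P s \<longleftrightarrow> finite (fst s) \<and> (\<forall>V\<in>fst s. open V \<and> V \<noteq> {}) \<and> fst s \<noteq> {} \<and> snd s \<in> A \<and> norm (snd s) \<le> 1"
    for s :: "'a set set \<times> ('a \<Rightarrow>\<^sub>C 'k)"
  define Q where "Q n s t \<longleftrightarrow> (\<forall>V\<in>fst s. \<forall>z. norm z = 1 \<longrightarrow>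
      (\<exists>W\<in>fst t. W \<subseteq> V \<and> (\<forall>x\<in>W. norm (snd t x - z) < \<epsilon> n)))"
    for n :: nat and s t :: "'a set set \<times> ('a \<Rightarrow>\<^sub>C 'k)"
  have "\<exists>s. P s"
    using A bcf.subspace_0 by (intro exI[of _ "({UNIV}, 0)"]) (auto simp: P_def somewhat_regular_def)
  moreover have "\<exists>t. P t \<and> Q n s t" if s: "P s" for n s
  proof -
    obtain \<W> f where Wf: "finite \<W>" "\<forall>W\<in>\<W>. open W \<and> W \<noteq> {}" "f \<in> A" "norm f \<le> 1"
      "\<forall>V\<in>fst s. \<forall>z. norm z = 1 \<longrightarrow> (\<exists>W\<in>\<W>. W \<subseteq> V \<and> (\<forall>x\<in>W. norm (f x - z) < \<epsilon> n))"
      using somewhat_regular_refine[OF A iso, of "fst s" "\<epsilon> n"] s e by (auto simp: P_def)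
    obtain V where "V \<in> fst s" using s by (auto simp: P_def)
    \<comment> \<open>Refining one set for the value \<open>z = 1\<close> already shows that the new
      family is non-empty.\<close>
    then have "\<exists>W. W \<in> \<W>" using Wf(5) norm_one by blast
    then have "P (\<W>, f)" using Wf(1-4) by (auto simp: P_def)
    moreover have "Q n s (\<W>, f)" using Wf(5) by (simp add: Q_def)
    ultimately show ?thesis by blast
  qed
  ultimately have "\<exists>s. \<forall>n. P (s n) \<and> Q n (s n) (s (Suc n))"
    by (intro dependent_nat_choice) blast+
  then obtain s where s: "\<And>n. P (s n)" "\<And>n. Q n (s n) (s (Suc n))"
    by blast
  \<comment> \<open>The shift discards the function of state 0, which \<open>Q\<close> does not
    constrain.\<close>
  define f where "f n = snd (s (Suc n))" for n
  \<comment> \<open>Each new set lies inside the previous one, so the earlier approximations persist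
    on it.\<close>
  have "\<exists>V\<in>fst (s N). \<forall>x\<in>V. \<forall>n<N. norm (f n x - z n) < \<epsilon> n" if z: "\<forall>n. norm (z n) = 1" for z N
  proof (induction N)
    case 0
    then show ?case using s(1)[of 0] by (auto simp: P_def)
  next
    case (Suc N)
    then obtain V where V: "V \<in> fst (s N)" "\<forall>x\<in>V. \<forall>n<N. norm (f n x - z n) < \<epsilon> n" by blast
    then obtain W where "W \<in> fst (s (Suc N))" "W \<subseteq> V" "\<forall>x\<in>W. norm (f N x - z N) < \<epsilon> N"
      using s(2)[of N] z unfolding Q_def f_def by blast
    with V show ?case by (auto simp: less_Suc_eq intro!: bexI[of _ W])
  qed
  then have "\<exists>x. \<forall>n<N. norm (f n x - z n) < \<epsilon> n" if "\<forall>n. norm (z n) = 1" for z N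
    using that s(1)[of N] unfolding P_def by (metis ex_in_conv)
  then show ?thesis using s(1) by (auto simp: P_def f_def intro!: exI[of _ f])
qed

section \<open>From patterns to asymptotically isometric sequences\<close>

text \<open>At a point where each \<open>f n\<close> nearly equals the scalar cancelling the
  argument of \<open>a n\<close>, the sum differs from the sum of all \<open>norm (a n)\<close> by
  at most the sum of all \<open>\<epsilon> n * norm (a n)\<close>.\<close>

lemma norm_sum_ge_of_patterns:
  fixes f :: "nat \<Rightarrow> 'a::topological_space \<Rightarrow>\<^sub>C 'k::real_normed_field"
  assumes "\<And>z N. (\<forall>n. norm (z n) = 1) \<Longrightarrow> \<exists>x. \<forall>n<N. norm (f n x - z n) < \<epsilon> n"
  shows "(\<Sum>n<N. (1 - \<epsilon> n) * norm (a n)) \<le> norm (\<Sum>n<N. scale_bcontfun (a n) (f n))"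
proof -
  \<comment> \<open>When \<open>a n = 0\<close> any unimodular value serves; 1 keeps the pattern on
    the unit sphere.\<close>
  define z where "z n = (if a n = 0 then 1 else of_real (norm (a n)) / a n)" for n
  have "\<forall>n. norm (z n) = 1" by (simp add: z_def norm_divide)
  then obtain x where x: "\<And>n. n < N \<Longrightarrow> norm (f n x - z n) < \<epsilon> n" using assms by blast
  have az: "a n * z n = of_real (norm (a n))" for n by (simp add: z_def)
  have "norm ((\<Sum>n<N. a n * z n) - (\<Sum>n<N. a n * f n x)) = norm (\<Sum>n<N. a n * (z n - f n x))"
    by (simp add: sum_subtractf algebra_simps)
  also have "\<dots> \<le> (\<Sum>n<N. \<epsilon> n * norm (a n))"
  proof (rule sum_norm_le)
    fix n assume "n \<in> {..<N}"
    then have "norm (z n - f n x) \<le> \<epsilon> n" using x[of n] by (simp add: norm_minus_commute less_imp_le)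
    then show "norm (a n * (z n - f n x)) \<le> \<epsilon> n * norm (a n)"
      by (simp add: norm_mult mult.commute[of "norm (a n)"] mult_right_mono)
  qed
  finally have "norm (\<Sum>n<N. a n * z n) \<le> (\<Sum>n<N. \<epsilon> n * norm (a n)) + norm (\<Sum>n<N. a n * f n x)"
    using norm_triangle_ineq2[of "\<Sum>n<N. a n * z n" "\<Sum>n<N. a n * f n x"] by linarith
  moreover have "norm (\<Sum>n<N. a n * z n) = (\<Sum>n<N. norm (a n))"
    by (simp add: az sum_nonneg flip: of_real_sum)
  moreover have "(\<Sum>n<N. a n * f n x) = (\<Sum>n<N. scale_bcontfun (a n) (f n)) x"
    by (simp add: apply_sum_bcontfun)
  ultimately show ?thesis
    using norm_bounded[of "\<Sum>n<N. scale_bcontfun (a n) (f n)" x]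
    by (simp add: left_diff_distrib sum_subtractf)
qed

text \<open>The upper estimate comes from \<open>norm (f n) \<le> 1\<close>, and the lower one
  passes from partial sums to the limit. Partial sums lie in \<open>A\<close>, but their limit is
  only known to lie in \<open>closure A\<close>.\<close>

lemma asymp_isometric_ell1_seqI:
  fixes f :: "nat \<Rightarrow> 'a::topological_space \<Rightarrow>\<^sub>C 'k::{real_normed_field,banach}"
  assumes A: "bcf.subspace A" and f: "\<And>n. f n \<in> A" "\<And>n. norm (f n) \<le> 1"
    and e: "\<And>n. 0 < \<epsilon> n \<and> \<epsilon> n < 1" "\<epsilon> \<longlonglongrightarrow> 0"
    and lower: "\<And>a N. (\<Sum>n<N. (1 - \<epsilon> n) * norm (a n)) \<le> norm (\<Sum>n<N. scale_bcontfun (a n) (f n))"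
  shows "asymp_isometric_ell1_seq (closure A) \<epsilon> f"
proof -
  have "\<exists>s\<in>closure A. (\<lambda>n. scale_bcontfun (a n) (f n)) sums s \<and>
      (\<Sum>n. (1 - \<epsilon> n) * norm (a n)) \<le> norm s \<and> norm s \<le> (\<Sum>n. norm (a n))"
    if "a \<in> ell1" for a
  proof -
    have a: "summable (\<lambda>n. norm (a n))" using that by (simp add: ell1_def)
    have le: "norm (scale_bcontfun (a n) (f n)) \<le> norm (a n)" for n
      using f(2)[of n] by (simp add: norm_scale_bcontfun mult_left_le)
    have sm: "summable (\<lambda>n. scale_bcontfun (a n) (f n))"
      by (rule summable_bcontfun_comparison[OF le a])
    define s where "s = (\<Sum>n. scale_bcontfun (a n) (f n))"
    have s: "(\<lambda>n. scale_bcontfun (a n) (f n)) sums s"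
      using sm by (simp add: s_def summable_sums)
    have lim: "(\<lambda>N. \<Sum>n<N. scale_bcontfun (a n) (f n)) \<longlonglongrightarrow> s"
      using s by (simp add: sums_def)
    have "norm ((1 - \<epsilon> n) * norm (a n)) \<le> norm (a n)" for n
      using e(1)[of n] by (simp add: abs_mult mult_left_le_one_le)
    then have "summable (\<lambda>n. (1 - \<epsilon> n) * norm (a n))"
      by (intro summable_comparison_test'[OF a, of 0]) simp
    then have "(\<lambda>N. \<Sum>n<N. (1 - \<epsilon> n) * norm (a n)) \<longlonglongrightarrow> (\<Sum>n. (1 - \<epsilon> n) * norm (a n))"
      by (rule summable_LIMSEQ)
    then have "(\<Sum>n. (1 - \<epsilon> n) * norm (a n)) \<le> norm s"
      using tendsto_norm[OF lim] lower by (intro LIMSEQ_le) auto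
    moreover have "norm s \<le> (\<Sum>n. norm (a n))"
    proof (rule LIMSEQ_le[OF tendsto_norm[OF lim] summable_LIMSEQ[OF a]])
      show "\<exists>N0. \<forall>N\<ge>N0. norm (\<Sum>n<N. scale_bcontfun (a n) (f n)) \<le> (\<Sum>n<N. norm (a n))"
        by (auto intro!: sum_norm_le le)
    qed
    moreover have "(\<Sum>n<N. scale_bcontfun (a n) (f n)) \<in> A" for N
      using A f by (intro bcf.subspace_sum bcf.subspace_scale) auto
    then have "s \<in> closure A"
      unfolding closure_sequential using lim
      by (intro exI[of _ "\<lambda>N. \<Sum>n<N. scale_bcontfun (a n) (f n)"]) simp
    ultimately show ?thesis using s by blast
  qed
  then show ?thesis
    using e f closure_subset[of A] by (auto simp: asymp_isometric_ell1_seq_def)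
qed

section \<open>From asymptotically isometric to isomorphic copies\<close>

text \<open>The map sending \<open>a\<close> to the sum of the series is linear and contractive. It
  is bounded below because the weights \<open>1 - \<epsilon> n\<close> are positive and tend to 1,
  hence stay above some \<open>c > 0\<close>.\<close>

lemma contains_ell1_if_asymp_isometric_ell1_seq:
  fixes X :: "('a::topological_space \<Rightarrow>\<^sub>C 'k::real_normed_field) set"
  assumes "asymp_isometric_ell1_seq X \<epsilon> x"
  shows "contains_ell1 X"
proof -
  have e: "\<And>n. 0 < \<epsilon> n \<and> \<epsilon> n < 1" "\<epsilon> \<longlonglongrightarrow> 0" and
    ex: "\<forall>a\<in>ell1. \<exists>s\<in>X. (\<lambda>n. scale_bcontfun (a n) (x n)) sums s \<and>
        (\<Sum>n. (1 - \<epsilon> n) * norm (a n)) \<le> norm s \<and> norm s \<le> (\<Sum>n. norm (a n))"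
    using assms unfolding asymp_isometric_ell1_seq_def by blast+
  define T where "T a = (\<Sum>n. scale_bcontfun (a n) (x n))" for a
  have T: "T a \<in> X \<and> (\<lambda>n. scale_bcontfun (a n) (x n)) sums T a \<and>
        (\<Sum>n. (1 - \<epsilon> n) * norm (a n)) \<le> norm (T a) \<and> norm (T a) \<le> ell1_norm a" if a: "a \<in> ell1" for a
  proof -
    obtain s where s: "s \<in> X" "(\<lambda>n. scale_bcontfun (a n) (x n)) sums s"
        "(\<Sum>n. (1 - \<epsilon> n) * norm (a n)) \<le> norm s" "norm s \<le> (\<Sum>n. norm (a n))"
      using ex a by blast
    moreover have "T a = s" using sums_unique[OF s(2)] by (simp add: T_def)
    ultimately show ?thesis by (simp add: ell1_norm_def)
  qed
  obtain c where c: "0 < c" "\<And>n. c \<le> 1 - \<epsilon> n"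
  proof -
    obtain N where N: "\<And>n. n \<ge> N \<Longrightarrow> \<epsilon> n < 1/2"
      using order_tendstoD(2)[OF e(2), of "1/2"] by (auto simp: eventually_sequentially)
    \<comment> \<open>The entry \<open>1/2\<close> serves all indices from \<open>N\<close> on and
      keeps the set non-empty when \<open>N = 0\<close>; the remaining weights are finitely
      many.\<close>
    define c where "c = Min (insert (1/2) ((\<lambda>n. 1 - \<epsilon> n) ` {..<N}))"
    have "0 < c" using e by (auto simp: c_def)
    moreover have "c \<le> 1 - \<epsilon> n" for n
    proof (cases "n < N")
      case True
      then show ?thesis by (auto simp: c_def intro!: Min_le)
    next
      case False
      have "c \<le> 1/2" unfolding c_def by (rule Min_le) auto
      then show ?thesis using N[of n] False by simp
    qed
    ultimately show ?thesis using that by blast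
  qed
  have lower: "ell1_norm a \<le> (1 / c) * norm (T a)" if a: "a \<in> ell1" for a
  proof -
    have sa: "summable (\<lambda>n. norm (a n))" using a by (simp add: ell1_def)
    have "norm ((1 - \<epsilon> n) * norm (a n)) \<le> norm (a n)" for n
      using e(1)[of n] by (simp add: abs_mult mult_left_le_one_le)
    then have sb: "summable (\<lambda>n. (1 - \<epsilon> n) * norm (a n))"
      by (intro summable_comparison_test'[OF sa, of 0]) simp
    have "c * ell1_norm a = (\<Sum>n. c * norm (a n))"
      using sa by (simp add: ell1_norm_def suminf_mult)
    also have "\<dots> \<le> (\<Sum>n. (1 - \<epsilon> n) * norm (a n))"
      using c sa sb by (intro suminf_le summable_mult mult_right_mono) auto
    also have "\<dots> \<le> norm (T a)" using T[OF a] by simp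
    finally show ?thesis using c by (simp add: field_simps)
  qed
  have ell1_add: "(\<lambda>n. a n + b n) \<in> ell1" if "a \<in> ell1" "b \<in> ell1" for a b :: "nat \<Rightarrow> 'k"
  proof -
    have "summable (\<lambda>n. norm (a n) + norm (b n))"
      using that by (auto simp: ell1_def intro: summable_add)
    then have "summable (\<lambda>n. norm (a n + b n))"
      by (rule summable_comparison_test'[of _ 0]) (simp add: norm_triangle_ineq)
    then show ?thesis by (simp add: ell1_def)
  qed
  have ell1_scale: "(\<lambda>n. k * a n) \<in> ell1" if "a \<in> ell1" for k and a :: "nat \<Rightarrow> 'k"
    using that by (auto simp: ell1_def norm_mult intro: summable_mult)
  have T_add: "T (\<lambda>n. a n + b n) = T a + T b" if "a \<in> ell1" "b \<in> ell1" for a b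
  proof (rule sums_unique2)
    show "(\<lambda>n. scale_bcontfun (a n + b n) (x n)) sums T (\<lambda>n. a n + b n)"
      using T[OF ell1_add[OF that]] by simp
    show "(\<lambda>n. scale_bcontfun (a n + b n) (x n)) sums (T a + T b)"
      using T[OF that(1)] T[OF that(2)] by (auto simp: bcf.scale_left_distrib intro: sums_add)
  qed
  \<comment> \<open>Multiplication by a fixed \<open>k\<close> is real-linear and bounded, so it may
    be applied termwise to a convergent series.\<close>
  have "bounded_linear (scale_bcontfun k :: _ \<Rightarrow> 'a \<Rightarrow>\<^sub>C 'k)" for k
    by (rule bounded_linear_intro[of _ "norm k"])
      (auto intro!: bcontfun_eqI simp: bcf.scale_right_distrib norm_scale_bcontfun mult.commute)
  note sums_scale = bounded_linear.sums[OF this]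
  have T_scale: "T (\<lambda>n. k * a n) = scale_bcontfun k (T a)" if "a \<in> ell1" for k a
  proof (rule sums_unique2)
    show "(\<lambda>n. scale_bcontfun (k * a n) (x n)) sums T (\<lambda>n. k * a n)"
      using T[OF ell1_scale[OF that]] by simp
    show "(\<lambda>n. scale_bcontfun (k * a n) (x n)) sums scale_bcontfun k (T a)"
      using T[OF that] sums_scale[of _ "T a" k] by (auto simp flip: bcf.scale_scale)
  qed
  have inj: "inj_on T ell1"
  proof (rule inj_onI)
    fix a b assume ab: "a \<in> ell1" "b \<in> ell1" "T a = T b"
    \<comment> \<open>The difference \<open>a - b\<close>, written so that additivity and
      homogeneity of \<open>T\<close> apply; the lower estimate then gives
      \<open>d = 0\<close>.\<close>
    define d where "d n = a n + (- 1) * b n" for n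
    have d: "d \<in> ell1" unfolding d_def using ab by (intro ell1_add ell1_scale)
    have "T d = T a + scale_bcontfun (- 1) (T b)"
      unfolding d_def using ab ell1_scale[of b "- 1"] T_add[of a "\<lambda>n. (- 1) * b n"] T_scale[of b "- 1"] by simp
    also have "\<dots> = 0" using ab(3) by (auto intro!: bcontfun_eqI simp: plus_bcontfun.rep_eq)
    finally have "ell1_norm d \<le> 0" using lower[OF d] by simp
    moreover have sd: "summable (\<lambda>n. norm (d n))" using d by (simp add: ell1_def)
    moreover have "0 \<le> ell1_norm d" unfolding ell1_norm_def by (rule suminf_nonneg[OF sd]) simp
    ultimately have "\<forall>n. norm (d n) = 0" 
      using suminf_eq_zero_iff[OF sd] by (simp add: ell1_norm_def)
    then show "a = b" by (auto simp: d_def)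
  qed
  have "bcf.subspace (T ` ell1)"
  proof (rule bcf.subspaceI)
    have z: "(\<lambda>n. 0::'k) \<in> ell1" by (simp add: ell1_def)
    then have "T (\<lambda>n. 0) = 0" using T_scale[OF z, of 0] by simp
    then show "0 \<in> T ` ell1" using z by (metis image_eqI)
  next
    fix u v assume "u \<in> T ` ell1" "v \<in> T ` ell1"
    then show "u + v \<in> T ` ell1" using ell1_add T_add by (force simp: image_iff)
  next
    fix k u assume "u \<in> T ` ell1"
    then show "scale_bcontfun k u \<in> T ` ell1"
      using ell1_scale by (auto simp flip: T_scale)
  qed
  moreover have "T ` ell1 \<subseteq> X" using T by auto
  moreover have "\<forall>a\<in>ell1. norm (T a) \<le> 1 * ell1_norm a" using T by simp
  ultimately show ?thesis
    unfolding contains_ell1_def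
    using inj lower T_add T_scale
    by (intro exI[of _ "T ` ell1"] exI[of _ T]) (blast intro: inj_on_imp_bij_betw)
qed

section \<open>Assembling the theorem\<close>

lemma somewhat_regular_ell1_seq:
  fixes A :: "('a::t2_space \<Rightarrow>\<^sub>C 'k::{real_normed_field,banach,heine_borel}) set"
  assumes A: "somewhat_regular A" and iso: "\<And>x::'a. \<not> open {x}"
  shows "\<exists>\<epsilon> x. range x \<subseteq> A \<and> asymp_isometric_ell1_seq (closure A) \<epsilon> x"
proof -
  \<comment> \<open>Starting at \<open>1/2\<close> rather than 1 keeps every
    \<open>\<epsilon> n\<close> strictly below 1.\<close>
  define \<epsilon> where "\<epsilon> n = inverse (real (Suc (Suc n)))" for n
  have e: "0 < \<epsilon> n \<and> \<epsilon> n < 1" for n by (simp add: \<epsilon>_def field_simps)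
  have e0: "\<epsilon> \<longlonglongrightarrow> 0"
    unfolding \<epsilon>_def by (rule LIMSEQ_Suc[OF LIMSEQ_inverse_real_of_nat])
  obtain f where f: "\<And>n. f n \<in> A" "\<And>n. norm (f n) \<le> 1"
      "\<And>z N. (\<forall>n. norm (z n) = 1) \<Longrightarrow> \<exists>x. \<forall>n<N. norm (f n x - z n) < \<epsilon> n"
    using somewhat_regular_all_patterns[OF A iso, of \<epsilon>] e by metis
  have "bcf.subspace A" using A by (simp add: somewhat_regular_def)
  then have "asymp_isometric_ell1_seq (closure A) \<epsilon> f"
    by (rule asymp_isometric_ell1_seqI[OF _ f(1,2) e e0]) (rule norm_sum_ge_of_patterns, rule f(3))
  then show ?thesis using f(1) by blast
qed

text \<open>For general \<open>A\<close> the sequence lies in \<open>A\<close> while the sums of its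
  series lie in \<open>closure A\<close>. For closed \<open>A\<close> the two sets agree, and the
  claims hold for \<open>A\<close> itself.\<close>

lemma somewhat_regular_contains_ell1:
  fixes A :: "('a::t2_space \<Rightarrow>\<^sub>C 'k::{real_normed_field,banach,heine_borel}) set"
  assumes "somewhat_regular A" and "\<forall>x::'a. \<not> open {x}"
  shows "(closed A \<longrightarrow> contains_ell1 A \<and> contains_asymp_isometric_ell1 A) \<and>
            contains_ell1 (closure A) \<and>
            (\<exists>\<epsilon> x. range x \<subseteq> A \<and> asymp_isometric_ell1_seq (closure A) \<epsilon> x)"
  using somewhat_regular_ell1_seq[of A] assms
  by (metis closure_closed contains_asymp_isometric_ell1_def
      contains_ell1_if_asymp_isometric_ell1_seq)

text \<open>The two choices of the scalar field are instances of one lemma over complete normed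
  fields with the Heine-Borel property.\<close>

theorem mainTheorem5:
  assumes "locally_compact_space (euclidean :: 'a::t2_space topology)"
    and "infinite (UNIV :: 'a set)"
    and "\<forall>x::'a. \<not> open {x}"
  shows "(\<forall>A :: ('a \<Rightarrow>\<^sub>C real) set. somewhat_regular A \<longrightarrow>
            (closed A \<longrightarrow> contains_ell1 A \<and> contains_asymp_isometric_ell1 A) \<and>
            contains_ell1 (closure A) \<and>
            (\<exists>\<epsilon> x. range x \<subseteq> A \<and> asymp_isometric_ell1_seq (closure A) \<epsilon> x)) \<and>
         (\<forall>A :: ('a \<Rightarrow>\<^sub>C complex) set. somewhat_regular A \<longrightarrow>
            (closed A \<longrightarrow> contains_ell1 A \<and> contains_asymp_isometric_ell1 A) \<and>
            contains_ell1 (closure A) \<and>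
            (\<exists>\<epsilon> x. range x \<subseteq> A \<and> asymp_isometric_ell1_seq (closure A) \<epsilon> x))"
  by (rule conjI; intro allI impI; rule somewhat_regular_contains_ell1; (assumption | rule assms(3)))

end
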